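(* Let $a>0$, $\gamma\ge0$ and $x$ be real. Then for all complex $t$ with $|t|<|a|$, $$\sum_{n=0}^{+\infty}\frac{t^n}{(\gamma+1)_n}\mathscr{C}_n(x;a,\gamma)=e^{t}\left(1-\frac{t}{a}\right)^{x}\Phi_1\left[\gamma,x+1;\gamma+1;\,\frac{t}{a},\,-t\right].$$ In particular, for the Charlier polynomials $C_n(x;a)=\mathscr{C}_n(x;a,0)$, $$\sum_{n=0}^{+\infty}\frac{t^n}{n!}C_n(x;a)=e^{t}\left(1-\frac{t}{a}\right)^{x}.$$
   Context: The associated Charlier polynomials $\mathscr{C}_n(x;a,\gamma)$ are defined by $\mathscr{C}_{-1}=0$, $\mathscr{C}_0=1$ and, for $n\ge0$, $$a\,\mathscr{C}_{n+1}(x;a,\gamma)=(n+\gamma+a-x)\,\mathscr{C}_n(x;a,\gamma)-(n+\gamma)\,\mathscr{C}_{n-1}(x;a,\gamma).$$ Pochhammer symbol: $(b)_0=1$, $(b)_k=b(b+1)\cdots(b+k-1)$. Powers use the principal branch. Humbert's confluent hypergeometric function is $$\Phi_1[\alpha_1,\lambda;\alpha_2;X,Y]=\sum_{m,n\ge0}\frac{(\alpha_1)_{m+n}(\lambda)_m}{(\alpha_2)_{m+n}}\frac{X^m}{m!}\frac{Y^n}{n!},\qquad |X|<1,\ |Y|<\infty.$$ *)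

theory Defs
  imports "HOL-Analysis.Analysis"
begin

text \<open>
  The sequence is indexed by natural numbers, so the second equation is the instance
  \<open>n = 0\<close> of the three-term recurrence with the value \<open>0\<close> at index \<open>-1\<close> inserted.
  Only \<open>a \<noteq> 0\<close> is meaningful.
\<close>
fun assoc_charlier :: "nat \<Rightarrow> real \<Rightarrow> real \<Rightarrow> real \<Rightarrow> real" where
  "assoc_charlier 0 x a \<gamma> = 1"
| "assoc_charlier (Suc 0) x a \<gamma> = (\<gamma> + a - x) / a"
| "assoc_charlier (Suc (Suc n)) x a \<gamma> =
     ((real (Suc n) + \<gamma> + a - x) * assoc_charlier (Suc n) x a \<gamma>
       - (real (Suc n) + \<gamma>) * assoc_charlier n x a \<gamma>) / a"

lemma assoc_charlier_recurrence:
  assumes "a \<noteq> 0"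
  shows "a * assoc_charlier (n + 1) x a \<gamma> =
           (real n + \<gamma> + a - x) * assoc_charlier n x a \<gamma>
             - (real n + \<gamma>) * (if n = 0 then 0 else assoc_charlier (n - 1) x a \<gamma>)"
  using assms by (cases n) simp_all

definition charlier :: "nat \<Rightarrow> real \<Rightarrow> real \<Rightarrow> real" where
  "charlier n x a = assoc_charlier n x a 0"

text \<open>
  The double series is summed unconditionally over all pairs \<open>(m, n)\<close>. It converges absolutely
  for \<open>norm X < 1\<close> when \<open>\<alpha>\<^sub>2\<close> is not a nonpositive integer, see
  \<open>humbert_Phi1_abs_summable\<close> below.
\<close>
definition humbert_Phi1 ::
    "complex \<Rightarrow> complex \<Rightarrow> complex \<Rightarrow> complex \<Rightarrow> complex \<Rightarrow> complex" where
  "humbert_Phi1 \<alpha>\<^sub>1 \<beta> \<alpha>\<^sub>2 X Y =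
     (\<Sum>\<^sub>\<infinity>(m, n)\<in>UNIV.
        pochhammer \<alpha>\<^sub>1 (m + n) * pochhammer \<beta> m / pochhammer \<alpha>\<^sub>2 (m + n)
          * (X ^ m / fact m) * (Y ^ n / fact n))"

lemma summable_norm_ratio_limit:
  fixes f q :: "nat \<Rightarrow> complex"
  assumes "\<And>n. f (Suc n) = q n * f n" and "q \<longlonglongrightarrow> L" and "norm L < 1"
  shows "summable (\<lambda>n. norm (f n))"
proof -
  obtain c where c: "norm L < c" "c < 1"
    using assms(3) dense by blast
  have "(\<lambda>n. norm (q n)) \<longlonglongrightarrow> norm L"
    using assms(2) by (rule tendsto_norm)
  then have "eventually (\<lambda>n. norm (q n) < c) sequentially"
    using c(1) by (rule order_tendstoD(2))
  then obtain N where N: "\<And>n. n \<ge> N \<Longrightarrow> norm (q n) < c"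
    by (auto simp: eventually_sequentially)
  show ?thesis
  proof (rule summable_ratio_test[OF c(2), of N])
    fix n assume "n \<ge> N"
    then show "norm (norm (f (Suc n))) \<le> c * norm (norm (f n))"
      using N[of n] by (simp add: assms(1) norm_mult mult_right_mono)
  qed
qed

lemma tendsto_shift_ratio:
  fixes b c :: complex
  shows "(\<lambda>n. (b + of_nat n) / (c + of_nat n)) \<longlonglongrightarrow> 1"
proof -
  have inv: "(\<lambda>n. inverse (of_nat n :: complex)) \<longlonglongrightarrow> 0"
    by (rule lim_inverse_n)
  have "(\<lambda>n. (b * inverse (of_nat n) + 1) / (c * inverse (of_nat n) + 1)) \<longlonglongrightarrow> (b * 0 + 1) / (c * 0 + 1)"
    by (intro tendsto_intros inv) simp
  moreover have "eventually (\<lambda>n. (b * inverse (of_nat n) + 1) / (c * inverse (of_nat n) + 1)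
      = (b + of_nat n) / (c + of_nat n)) sequentially"
    using eventually_gt_at_top[of 0]
  proof eventually_elim
    case (elim n)
    then have n: "(of_nat n :: complex) \<noteq> 0" by simp
    then have "b * inverse (of_nat n) + 1 = (b + of_nat n) / of_nat n"
      and "c * inverse (of_nat n) + 1 = (c + of_nat n) / of_nat n"
      by (simp_all add: field_simps)
    then show ?case using n by simp
  qed
  ultimately show ?thesis
    using tendsto_cong by force
qed

lemma humbert_Phi1_abs_summable:
  fixes \<alpha>\<^sub>1 \<beta> \<alpha>\<^sub>2 X Y :: complex
  assumes "norm X < 1" and "\<alpha>\<^sub>2 \<notin> \<int>\<^sub>\<le>\<^sub>0"
  shows "(\<lambda>(m, n). norm (
        pochhammer \<alpha>\<^sub>1 (m + n) * pochhammer \<beta> m / pochhammer \<alpha>\<^sub>2 (m + n)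
          * (X ^ m / fact m) * (Y ^ n / fact n))) summable_on UNIV"
proof -
  obtain r where r: "1 < r" "r * norm X < 1"
  proof (cases "X = 0")
    case True
    then show ?thesis using that[of 2] by simp
  next
    case False
    then have "1 < 1 / norm X" using assms(1) by simp
    then obtain s where "1 < s" "s < 1 / norm X" using dense by blast
    then show ?thesis using that[of s] False by (simp add: field_simps)
  qed
  define R where "R = complex_of_real r"
  have R: "norm R = r" "R \<noteq> 0" using r(1) by (auto simp: R_def)
  define f where "f k = pochhammer \<alpha>\<^sub>1 k / (pochhammer \<alpha>\<^sub>2 k * R ^ k)" for k
  define g where "g m = pochhammer \<beta> m * (R * X) ^ m / fact m" for m
  define h where "h n = (R * Y) ^ n / fact n" for n
  have "summable (\<lambda>k. norm (f k))"
  proof (rule summable_norm_ratio_limit)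
    show "f (Suc k) = (\<alpha>\<^sub>1 + of_nat k) / (\<alpha>\<^sub>2 + of_nat k) * inverse R * f k" for k
      by (simp add: f_def pochhammer_Suc field_simps)
    show "(\<lambda>k. (\<alpha>\<^sub>1 + of_nat k) / (\<alpha>\<^sub>2 + of_nat k) * inverse R) \<longlonglongrightarrow> 1 * inverse R"
      by (intro tendsto_mult tendsto_shift_ratio tendsto_const)
    show "norm (1 * inverse R) < 1"
      using R r(1) by (simp add: norm_inverse inverse_less_1_iff)
  qed
  then have "f \<longlonglongrightarrow> 0"
    by (rule summable_LIMSEQ_zero[OF summable_norm_cancel])
  then have "Bseq f"
    by (intro convergent_imp_Bseq convergentI)
  then obtain B where B: "\<And>k. norm (f k) \<le> B"
    by (meson BseqE)
  have g: "summable (\<lambda>m. norm (g m))"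
  proof (rule summable_norm_ratio_limit)
    show "g (Suc m) = (\<beta> + of_nat m) / (1 + of_nat m) * (R * X) * g m" for m
      by (simp add: g_def pochhammer_Suc)
    show "(\<lambda>m. (\<beta> + of_nat m) / (1 + of_nat m) * (R * X)) \<longlonglongrightarrow> 1 * (R * X)"
      by (intro tendsto_mult tendsto_shift_ratio tendsto_const)
    show "norm (1 * (R * X)) < 1"
      using R r(2) by (simp add: norm_mult)
  qed
  have h: "summable (\<lambda>n. norm (h n))"
    using summable_exp[of "norm (R * Y)"]
    by (simp add: h_def norm_divide norm_power norm_mult power_mult_distrib divide_inverse mult_ac norm_inverse)
  have gs: "(\<lambda>m. B * norm (g m)) summable_on UNIV" for B
    by (intro summable_on_cmult_right norm_summable_imp_summable_on) (use g in simp)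
  have hs: "(\<lambda>n. norm (h n)) summable_on UNIV"
    by (rule norm_summable_imp_summable_on) (use h in simp)
  have "(\<lambda>p. B * norm (g (fst p)) * norm (h (snd p))) summable_on (UNIV \<times> UNIV)"
  proof (rule summable_on_SigmaI)
    show "((\<lambda>n. B * norm (g (fst (m, n))) * norm (h (snd (m, n))))
        has_sum (B * infsum (\<lambda>n. norm (h n)) UNIV) * norm (g m)) UNIV" for m
      using has_sum_cmult_right[OF has_sum_infsum[OF hs], of "B * norm (g m)"]
      by (simp add: mult_ac)
    show "(\<lambda>m. (B * infsum (\<lambda>n. norm (h n)) UNIV) * norm (g m)) summable_on UNIV"
      by (rule gs)
    have "0 \<le> B" using B[of 0] norm_ge_zero order_trans by blast
    then show "0 \<le> B * norm (g (fst (m, n))) * norm (h (snd (m, n)))" for m n by simp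
  qed
  then have "(\<lambda>p. B * norm (g (fst p)) * norm (h (snd p))) summable_on UNIV"
    by simp
  then show ?thesis
  proof (rule summable_on_comparison_test, goal_cases)
    case (1 p)
    obtain m n where p: "p = (m, n)" by (cases p)
    have "pochhammer \<alpha>\<^sub>1 (m + n) * pochhammer \<beta> m / pochhammer \<alpha>\<^sub>2 (m + n)
          * (X ^ m / fact m) * (Y ^ n / fact n) = f (m + n) * g m * h n"
      using R(2) by (simp add: f_def g_def h_def power_add power_mult_distrib)
    then show ?case
      using B[of "m + n"] by (simp add: p norm_mult mult_right_mono)
  next
    case (2 p)
    then show ?case by (simp add: case_prod_beta)
  qed
qed

end

theory Submission
  imports Defs
begin

unbundle no vec_syntax and fps_syntax

text \<open>
  The coefficients \<open>C\<^sub>n / (\<gamma> + 1)\<^sub>n\<close> obey a recurrence that says that their generating series \<open>F\<close>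
  solves \<open>t (1 - t/a) F' + \<gamma> (1 - t/a) F = t (1 - t/a - x/a) F + \<gamma>\<close>. Dividing by
  \<open>G = exp t (1 - t/a)\<^sup>x\<close> turns this into \<open>t H' + \<gamma> H = \<gamma> exp (-t) (1 - t/a)\<^sup>-\<^sup>x\<^sup>-\<^sup>1\<close>,
  so the coefficients of \<open>H\<close> are those of the right-hand side times \<open>1 / (\<gamma> + k) = (\<gamma>)\<^sub>k / (\<gamma> (\<gamma> + 1)\<^sub>k)\<close>,
  which are the diagonal sums of the series \<open>\<Phi>\<^sub>1\<close>. The identity \<open>F = G H\<close> is checked for formal power
  series and then evaluated by absolute convergence.
\<close>

section \<open>The formal binomial series of (1 - c t)^y\<close>

definition fps_one_minus_powr :: "'a::field_char_0 \<Rightarrow> 'a \<Rightarrow> 'a fps" where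
  "fps_one_minus_powr c y = Abs_fps (\<lambda>n. pochhammer (- y) n / fact n * c ^ n)"

lemma fps_one_minus_powr_nth [simp]:
  "fps_one_minus_powr c y $ n = pochhammer (- y) n / fact n * c ^ n"
  by (simp add: fps_one_minus_powr_def)

text \<open>Vandermonde's convolution for rising factorials; the powers of \<open>c\<close> combine
  to \<open>c ^ n\<close>.\<close>

lemma fps_one_minus_powr_add:
  "fps_one_minus_powr c (y + z) = fps_one_minus_powr c y * fps_one_minus_powr c z"
proof (rule fps_ext)
  fix n
  have "(fps_one_minus_powr c y * fps_one_minus_powr c z) $ n =
      (\<Sum>k\<le>n. (of_nat (n choose k) * pochhammer (- y) k * pochhammer (- z) (n - k)) * (c ^ n / fact n))"
    unfolding fps_mult_nth atLeast0AtMost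
    by (intro sum.cong refl) (simp add: binomial_fact field_simps flip: power_add)
  also have "\<dots> = pochhammer (- y + - z) n * (c ^ n / fact n)"
    by (simp only: pochhammer_binomial_sum sum_distrib_right)
  also have "- y + - z = - (y + z)" by simp
  finally show "fps_one_minus_powr c (y + z) $ n = (fps_one_minus_powr c y * fps_one_minus_powr c z) $ n"
    by simp
qed

text \<open>At exponent -1 every factor \<open>pochhammer 1 n / fact n\<close> is 1, which leaves
  the geometric series.\<close>

lemma fps_one_minus_powr_neg_one:
  "(1 - fps_const c * fps_X) * fps_one_minus_powr c (- 1) = 1"
proof (rule fps_ext)
  fix n show "((1 - fps_const c * fps_X) * fps_one_minus_powr c (- 1)) $ n = 1 $ n"
    by (cases n) (simp_all add: left_diff_distrib mult.assoc pochhammer_fact[symmetric] del: of_nat_Suc)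
qed

lemma fps_deriv_one_minus_powr:
  "(1 - fps_const c * fps_X) * fps_deriv (fps_one_minus_powr c y)
     = - fps_const (y * c) * fps_one_minus_powr c y"
proof (rule fps_ext)
  fix n
  \<comment> \<open>The differential equation read coefficientwise: a first-order recursion from one
    new factor of the rising factorial.\<close>
  have *: "of_nat (Suc n) * fps_one_minus_powr c y $ Suc n = (of_nat n - y) * c * fps_one_minus_powr c y $ n" for n
    by (simp add: pochhammer_Suc field_simps del: of_nat_Suc)
  show "((1 - fps_const c * fps_X) * fps_deriv (fps_one_minus_powr c y)) $ n =
        (- fps_const (y * c) * fps_one_minus_powr c y) $ n"
    using *[of n]
    by (cases n) (simp_all add: left_diff_distrib mult.assoc algebra_simps
         del: of_nat_Suc fps_one_minus_powr_nth)
qed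

section \<open>The series \<open>G\<close> and \<open>H\<close>, their differential equation and the
  resulting recurrence\<close>

definition charlier_factor :: "'a::field_char_0 \<Rightarrow> 'a \<Rightarrow> 'a fps" where
  "charlier_factor a x = fps_exp 1 * fps_one_minus_powr (1 / a) x"

text \<open>In the Humbert series the quotient of Pochhammer symbols depends on k = m + n only, and
  the rest of the diagonal sum is a Cauchy product. Keeping the quotient instead of g / (g + k)
  gives the correct value 1 at g = k = 0.\<close>

definition humbert_fps :: "'a::field_char_0 \<Rightarrow> 'a \<Rightarrow> 'a \<Rightarrow> 'a fps" where
  "humbert_fps a x g = Abs_fps (\<lambda>k. pochhammer g k / pochhammer (g + 1) k
      * (fps_one_minus_powr (1 / a) (- x - 1) * fps_exp (- 1)) $ k)"

text \<open>Both (g + k) (g)_k and g (g + 1)_k equal (g)_{k+1}. The form without division by g + k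
  covers g = k = 0.\<close>

lemma pochhammer_ratio_Suc:
  fixes g :: "'a::field_char_0"
  assumes "pochhammer (g + 1) k \<noteq> 0"
  shows "(g + of_nat k) * (pochhammer g k / pochhammer (g + 1) k) = g"
proof -
  have "(g + of_nat k) * pochhammer g k = g * pochhammer (g + 1) k"
    using pochhammer_rec[of g k] pochhammer_Suc[of g k] by (simp add: mult.commute)
  then show ?thesis using assms by (simp add: field_simps)
qed

lemma charlier_fps_ode:
  fixes a x g :: "'a::field_char_0"
  defines "F \<equiv> charlier_factor a x * humbert_fps a x g" and "L \<equiv> 1 - fps_const (1 / a) * fps_X"
  assumes nz: "\<And>k. pochhammer (g + 1) k \<noteq> 0"
  shows "fps_X * L * fps_deriv F + fps_const g * L * F
           = fps_X * (L - fps_const (x / a)) * F + fps_const g"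
proof -
  define G where "G = charlier_factor a x"
  define H where "H = humbert_fps a x g"
  define P where "P = fps_one_minus_powr (1 / a)"
  define K where "K = P (- x - 1) * fps_exp (- 1)"
  have "L * fps_deriv G = L * G + fps_exp 1 * (L * fps_deriv (P x))"
    by (simp add: G_def charlier_factor_def P_def algebra_simps)
  also have "\<dots> = L * G - fps_const (x / a) * G"
    unfolding L_def P_def fps_deriv_one_minus_powr
    by (simp add: G_def charlier_factor_def mult.left_commute flip: fps_const_neg)
  finally have G': "L * fps_deriv G = (L - fps_const (x / a)) * G"
    by (simp add: algebra_simps)
  have H': "fps_X * fps_deriv H + fps_const g * H = fps_const g * K"
  proof (rule fps_ext)
    fix k
    \<comment> \<open>The Euler operator \<open>fps_X * fps_deriv\<close> multiplies the k-th
      coefficient by k.\<close>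
    have "(fps_X * fps_deriv H + fps_const g * H) $ k = (g + of_nat k) * H $ k"
      by (cases k) (simp_all add: algebra_simps)
    also have "\<dots> = ((g + of_nat k) * (pochhammer g k / pochhammer (g + 1) k)) * K $ k"
      by (simp add: H_def humbert_fps_def K_def P_def)
    also have "\<dots> = g * K $ k"
      by (simp only: pochhammer_ratio_Suc[OF nz])
    finally show "(fps_X * fps_deriv H + fps_const g * H) $ k = (fps_const g * K) $ k"
      by simp
  qed
  \<comment> \<open>The exponents x and - x - 1 add up to -1 and the exponentials cancel, so
    \<open>G * K\<close> is the inverse of \<open>L\<close>.\<close>
  have "P x * P (- x - 1) = P (- 1)"
    by (simp add: P_def flip: fps_one_minus_powr_add)
  moreover have "fps_exp 1 * fps_exp (- 1) = (1 :: 'a fps)"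
    by (simp flip: fps_exp_add_mult)
  ultimately have "G * K = P (- 1)"
    by (metis (no_types, lifting) G_def K_def P_def charlier_factor_def mult.assoc mult.commute mult_1)
  then have GK: "L * (G * K) = 1"
    by (simp add: L_def P_def fps_one_minus_powr_neg_one)
  have "fps_X * L * fps_deriv F + fps_const g * L * F
      = fps_X * (L * fps_deriv G) * H + L * G * (fps_X * fps_deriv H + fps_const g * H)"
    by (simp add: F_def G_def H_def algebra_simps)
  also have "\<dots> = fps_X * (L - fps_const (x / a)) * F + fps_const g * (L * (G * K))"
    unfolding G' H' by (simp add: F_def G_def H_def mult_ac)
  finally show ?thesis by (simp add: GK)
qed

text \<open>Coefficient \<open>Suc n\<close> of the differential equation, multiplied by
  \<open>a\<close>; the constant \<open>fps_const g\<close> contributes to coefficient 0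
  only.\<close>

lemma charlier_fps_recurrence:
  fixes a x g :: "'a::field_char_0"
  defines "F \<equiv> charlier_factor a x * humbert_fps a x g"
  assumes nz: "\<And>k. pochhammer (g + 1) k \<noteq> 0" and a: "a \<noteq> 0"
  shows "a * (g + 1 + of_nat n) * F $ Suc n
           = (of_nat n + g + a - x) * F $ n - (if n = 0 then 0 else F $ (n - 1))"
proof -
  have "(fps_X * (1 - fps_const (1 / a) * fps_X) * fps_deriv F + fps_const g * (1 - fps_const (1 / a) * fps_X) * F) $ Suc n
      = (fps_X * ((1 - fps_const (1 / a) * fps_X) - fps_const (x / a)) * F + fps_const g) $ Suc n"
    unfolding F_def by (simp only: charlier_fps_ode[OF nz])
  then have *: "of_nat (Suc n) * F $ Suc n - 1 / a * (of_nat n * F $ n) + g * (F $ Suc n - 1 / a * F $ n)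
      = F $ n - 1 / a * (if n = 0 then 0 else F $ (n - 1)) - x / a * F $ n"
    by (cases n) (simp_all add: left_diff_distrib right_diff_distrib mult.assoc del: of_nat_Suc)
  have "a * (of_nat (Suc n) * F $ Suc n - 1 / a * (of_nat n * F $ n) + g * (F $ Suc n - 1 / a * F $ n))
      = a * (F $ n - 1 / a * (if n = 0 then 0 else F $ (n - 1)) - x / a * F $ n)"
    by (simp only: *)
  then show ?thesis
    using a by (cases "n = 0") (simp_all add: algebra_simps)
qed

section \<open>Identification of the coefficients with the polynomials\<close>

lemma pochhammer_of_real_add_one_nonzero:
  assumes "\<gamma> \<ge> 0"
  shows "pochhammer (complex_of_real \<gamma> + 1) k \<noteq> 0"
proof -
  have "pochhammer (\<gamma> + 1) k > 0"
    using assms by (intro pochhammer_pos) simp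
  then have "complex_of_real (pochhammer (\<gamma> + 1) k) \<noteq> 0"
    by simp
  then show ?thesis
    by (metis pochhammer_of_real of_real_add of_real_1)
qed

lemma assoc_charlier_eq_fps_nth:
  fixes a \<gamma> x :: real
  defines "F \<equiv> charlier_factor (complex_of_real a) (of_real x) * humbert_fps (of_real a) (of_real x) (of_real \<gamma>)"
  assumes a: "a > 0" and \<gamma>: "\<gamma> \<ge> 0"
  shows "of_real (assoc_charlier n x a \<gamma>) = pochhammer (of_real \<gamma> + 1) n * F $ n"
proof -
  note nz = pochhammer_of_real_add_one_nonzero[OF \<gamma>]
  have a0: "complex_of_real a \<noteq> 0" using a by simp
  note rec = charlier_fps_recurrence[OF nz a0, where x = "of_real x", folded F_def]
  \<comment> \<open>The recurrence determines all further coefficients from this one.\<close>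
  have F0: "F $ 0 = 1"
    by (simp add: F_def charlier_factor_def humbert_fps_def)
  show ?thesis
  proof (induction n rule: induct_nat_012)
    case 0
    then show ?case by (simp add: F0)
  next
    case 1
    then show ?case
      using rec[of 0] a0 by (simp add: F0 field_simps)
  next
    case (ge2 n)
    define p where "p = pochhammer (complex_of_real \<gamma> + 1) n"
    \<comment> \<open>The factor that takes the Pochhammer symbol from index n to n + 1 is also the
      coefficient n + 1 + \<gamma> in the recurrence of the polynomials.\<close>
    define q where "q = complex_of_real \<gamma> + 1 + of_nat n"
    have p: "pochhammer (complex_of_real \<gamma> + 1) (Suc n) = p * q"
      and p': "pochhammer (complex_of_real \<gamma> + 1) (Suc (Suc n)) = p * q * (q + 1)"
      by (simp_all add: p_def q_def pochhammer_Suc algebra_simps)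
    have r: "of_real a * (q + 1) * F $ Suc (Suc n) = (q + of_real a - of_real x) * F $ Suc n - F $ n"
      using rec[of "Suc n"] by (simp add: q_def algebra_simps)
    have "of_real a * of_real (assoc_charlier (Suc (Suc n)) x a \<gamma>)
        = (q + of_real a - of_real x) * (p * q * F $ Suc n) - q * (p * F $ n)"
      using a0 ge2 by (simp add: p p_def[symmetric]) (simp add: q_def algebra_simps)
    also have "\<dots> = p * q * ((q + of_real a - of_real x) * F $ Suc n - F $ n)"
      by (simp add: algebra_simps)
    also have "\<dots> = of_real a * (p * q * (q + 1) * F $ Suc (Suc n))"
      unfolding r[symmetric] by (simp add: mult_ac)
    finally show ?case
      using a0 unfolding p' by simp
  qed
qed

section \<open>Convergence and evaluation on the disc\<close>

lemma sums_on_disc_imp_norm_summable: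
  fixes f :: "nat \<Rightarrow> complex"
  assumes "\<And>s. norm s < R \<Longrightarrow> (\<lambda>n. f n * s ^ n) sums S s" and "norm t < R"
  shows "summable (\<lambda>n. norm (f n * t ^ n))"
proof -
  obtain r where r: "norm t < r" "r < R"
    \<comment> \<open>Convergence at a real point strictly between |t| and \<open>R\<close> forces
      absolute convergence at \<open>t\<close>.\<close>
    using dense[OF assms(2)] by blast
  then have "r > 0" using norm_ge_zero[of t] by linarith
  then have "norm (complex_of_real r) = r" by simp
  then show ?thesis
    using assms(1)[of "of_real r"] r
    by (intro powser_insidea[of f "of_real r"]) (auto dest: sums_summable)
qed

text \<open>The generalised binomial theorem at - c t: the sign (-1)^n from rewriting the binomial
  coefficient as a rising factorial cancels the sign of (- c t)^n.\<close>

lemma fps_one_minus_powr_sums: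
  fixes c y t :: complex
  assumes "norm (c * t) < 1"
  shows "(\<lambda>n. fps_one_minus_powr c y $ n * t ^ n) sums ((1 - c * t) powr y)"
proof -
  have "fps_one_minus_powr c y $ n * t ^ n = (y gchoose n) * (- (c * t)) ^ n" for n
  proof -
    have "(- 1) ^ n * (- 1) ^ n = (1 :: complex)"
      by (simp flip: power_mult_distrib)
    moreover have "(y gchoose n) * (- (c * t)) ^ n
        = ((- 1) ^ n * (- 1) ^ n) * (pochhammer (- y) n / fact n * c ^ n * t ^ n)"
      by (simp only: gbinomial_pochhammer power_minus[of "c * t"] power_mult_distrib) (simp add: mult_ac)
    ultimately show ?thesis by simp
  qed
  then show ?thesis
    using gen_binomial_complex[of "- (c * t)" y] assms by simp
qed

lemma charlier_factor_sums:
  fixes a x t :: complex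
  assumes "a \<noteq> 0" "norm t < norm a"
  shows "(\<lambda>n. charlier_factor a x $ n * t ^ n) sums (exp t * (1 - t / a) powr x)"
proof -
  have disc: "norm (1 / a * s) < 1" if "norm s < norm a" for s
    using that assms(1) by (simp add: norm_divide)
  have e: "(\<lambda>n. fps_exp 1 $ n * t ^ n) sums exp t" "summable (\<lambda>n. norm (fps_exp 1 $ n * t ^ n))"
    using exp_converges[of t] summable_norm_exp[of t]
    by (simp_all add: scaleR_conv_of_real divide_inverse mult.commute)
  note p = fps_one_minus_powr_sums[OF disc, of _ x]
  have "(\<lambda>n. \<Sum>i\<le>n. (fps_exp 1 $ i * t ^ i) * (fps_one_minus_powr (1 / a) x $ (n - i) * t ^ (n - i))) sums
      ((\<Sum>n. fps_exp 1 $ n * t ^ n) * (\<Sum>n. fps_one_minus_powr (1 / a) x $ n * t ^ n))"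
    by (intro Cauchy_product_sums e sums_on_disc_imp_norm_summable[OF p]) (use assms in auto)
  moreover have "(\<Sum>i\<le>n. (fps_exp 1 $ i * t ^ i) * (fps_one_minus_powr (1 / a) x $ (n - i) * t ^ (n - i)))
      = charlier_factor a x $ n * t ^ n" for n
    unfolding charlier_factor_def fps_mult_nth atLeast0AtMost sum_distrib_right
    by (intro sum.cong refl) (simp flip: power_add add: mult_ac)
  ultimately show ?thesis
    using sums_unique[OF p[OF assms(2)]] sums_unique[OF e(1)] by simp
qed

text \<open>Absolute convergence of the double series permits summing it along the diagonals m + n =
  k.\<close>

lemma humbert_fps_sums:
  fixes a x t g :: complex
  assumes "a \<noteq> 0" "norm t < norm a" "g + 1 \<notin> \<int>\<^sub>\<le>\<^sub>0"
  shows "(\<lambda>n. humbert_fps a x g $ n * t ^ n) sums humbert_Phi1 g (x + 1) (g + 1) (t / a) (- t)"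
proof -
  define T where "T = (\<lambda>(m, n). pochhammer g (m + n) * pochhammer (x + 1) m / pochhammer (g + 1) (m + n)
          * ((t / a) ^ m / fact m) * ((- t) ^ n / fact n))"
  have "norm (t / a) < 1"
    using assms by (simp add: norm_divide)
  from humbert_Phi1_abs_summable[OF this assms(3), of g "x + 1" "- t"]
  have "(\<lambda>p. norm (T p)) summable_on UNIV"
    by (simp add: T_def case_prod_beta')
  then have "T summable_on UNIV"
    by (rule abs_summable_summable)
  then have "(T has_sum humbert_Phi1 g (x + 1) (g + 1) (t / a) (- t)) UNIV"
    unfolding humbert_Phi1_def T_def by (rule has_sum_infsum)
  \<comment> \<open>A pair (m, n) is encoded by its diagonal k = m + n and its position m
    there.\<close>
  moreover have "bij_betw (\<lambda>(k, m). (m, k - m)) (SIGMA k:UNIV. {..k}) (UNIV :: (nat \<times> nat) set)"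
    by (rule bij_betwI[where g = "\<lambda>(m, n). (m + n, m)"]) auto
  ultimately have "((\<lambda>p. T (case p of (k, m) \<Rightarrow> (m, k - m))) has_sum
      humbert_Phi1 g (x + 1) (g + 1) (t / a) (- t)) (SIGMA k:UNIV. {..k})"
    by (subst has_sum_reindex_bij_betw)
  then have "((\<lambda>k. \<Sum>m\<le>k. T (m, k - m)) has_sum humbert_Phi1 g (x + 1) (g + 1) (t / a) (- t)) UNIV"
    by (rule has_sum_SigmaD) (auto intro: has_sum_finite)
  moreover have "(\<Sum>m\<le>k. T (m, k - m)) = humbert_fps a x g $ k * t ^ k" for k
  proof -
    have "T (m, k - m) = pochhammer g k / pochhammer (g + 1) k
        * (fps_one_minus_powr (1 / a) (- x - 1) $ m * fps_exp (- 1) $ (k - m)) * t ^ k" if "m \<le> k" for m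
    proof -
      have "t ^ k = t ^ m * t ^ (k - m)"
        using that by (simp flip: power_add)
      then show ?thesis
        using that by (simp add: T_def power_divide power_minus[of t] mult_ac add.commute[of 1])
    qed
    then show ?thesis
      unfolding humbert_fps_def fps_nth_Abs_fps fps_mult_nth atLeast0AtMost sum_distrib_left sum_distrib_right
      by (intro sum.cong refl) simp
  qed
  ultimately show ?thesis
    using has_sum_imp_sums by simp
qed

text \<open>The symbol (0)_{m+n} vanishes unless m = n = 0, so a single term remains.\<close>

lemma humbert_Phi1_zero: "humbert_Phi1 0 b c X Y = 1"
proof -
  have "humbert_Phi1 0 b c X Y = (\<Sum>\<^sub>\<infinity>(m, n)\<in>{(0, 0)}.
        pochhammer 0 (m + n) * pochhammer b m / pochhammer c (m + n)
          * (X ^ m / fact m) * (Y ^ n / fact n))"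
    unfolding humbert_Phi1_def
    by (intro infsum_cong_neutral) (auto simp: pochhammer_0_left split: if_splits)
  then show ?thesis by simp
qed

theorem proposition3p1:
  fixes a \<gamma> x :: real and t :: complex
  assumes "a > 0" and "\<gamma> \<ge> 0" and "norm t < \<bar>a\<bar>"
  shows "(\<lambda>n. t ^ n / pochhammer (of_real \<gamma> + 1) n * of_real (assoc_charlier n x a \<gamma>)) sums
           (exp t * (1 - t / of_real a) powr of_real x
             * humbert_Phi1 (of_real \<gamma>) (of_real x + 1) (of_real \<gamma> + 1) (t / of_real a) (- t)) \<and>
         (\<lambda>n. t ^ n / fact n * of_real (charlier n x a)) sums
           (exp t * (1 - t / of_real a) powr of_real x)"
proof -
  \<comment> \<open>Proved for every g \<ge> 0, because the two claims are the instances
    \<open>g = \<gamma>\<close> and \<open>g = 0\<close>.\<close>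
  have sums: "(\<lambda>n. t ^ n / pochhammer (of_real g + 1) n * of_real (assoc_charlier n x a g)) sums
      (exp t * (1 - t / of_real a) powr of_real x
        * humbert_Phi1 (of_real g) (of_real x + 1) (of_real g + 1) (t / of_real a) (- t))"
    if g: "g \<ge> 0" for g :: real
  proof -
    define G where "G = charlier_factor (complex_of_real a) (of_real x)"
    define H where "H = humbert_fps (complex_of_real a) (of_real x) (of_real g)"
    have a: "complex_of_real a \<noteq> 0" "norm t < norm (complex_of_real a)"
      using assms by simp_all
    \<comment> \<open>If g + 1 were -k, then (g + 1)_{k+1} would contain the factor 0.\<close>
    have "of_real g + 1 \<notin> (\<int>\<^sub>\<le>\<^sub>0 :: complex set)"
      using pochhammer_of_real_add_one_nonzero[OF g] pochhammer_eq_0_iff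
      by (metis nonpos_Ints_cases' lessI)
    note Hs = humbert_fps_sums[OF a(1) _ this, of _ "of_real x", folded H_def]
    note Gs = charlier_factor_sums[OF a(1), of _ "of_real x", folded G_def]
    have "(\<lambda>n. \<Sum>i\<le>n. (G $ i * t ^ i) * (H $ (n - i) * t ^ (n - i))) sums
        ((\<Sum>n. G $ n * t ^ n) * (\<Sum>n. H $ n * t ^ n))"
      using a(2)
      by (intro Cauchy_product_sums sums_on_disc_imp_norm_summable[OF Gs] sums_on_disc_imp_norm_summable[OF Hs])
    moreover have "(\<Sum>i\<le>n. (G $ i * t ^ i) * (H $ (n - i) * t ^ (n - i)))
        = t ^ n / pochhammer (of_real g + 1) n * of_real (assoc_charlier n x a g)" for n
    proof -
      have "(\<Sum>i\<le>n. (G $ i * t ^ i) * (H $ (n - i) * t ^ (n - i))) = t ^ n * (G * H) $ n"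
        unfolding fps_mult_nth atLeast0AtMost sum_distrib_left
        by (intro sum.cong refl) (simp flip: power_add add: mult_ac)
      then show ?thesis
        using pochhammer_of_real_add_one_nonzero[OF g, of n]
        by (simp add: assoc_charlier_eq_fps_nth assms g G_def H_def)
    qed
    ultimately show ?thesis
      using sums_unique[OF Gs[OF a(2)]] sums_unique[OF Hs[OF a(2)]] by simp
  qed
  show ?thesis
    \<comment> \<open>At parameter 0 the Humbert factor is 1 and (1)_n = n!.\<close>
    using sums[OF assms(2)] sums[of 0]
    by (simp add: humbert_Phi1_zero charlier_def pochhammer_fact[symmetric])
qed

end
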